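(* Let $I=(0,1)$ and let $\tilde u,H\in L^\infty(I)$ be real-valued with $\inf_IH>0$. Let $A_0:L^2(I)^2\to L^2(I)^2$ be the bounded operator $$A_0\begin{pmatrix}\phi_1\\ \phi_2\end{pmatrix}=\begin{pmatrix}\tilde u\,\phi_1+H\phi_2\\ g\int_0^1\phi_1\,\mathrm{d}\lambda+\tilde u\,\phi_2\end{pmatrix}.$$ Set $\tilde u_-=\inf_I\tilde u$, $\tilde u_+=\sup_I\tilde u$, $h=\int_0^1H\,\mathrm{d}\lambda$. Then the spectrum $\sigma(A_0)$ is contained in the union of the three sets $$J_-=\bigl[\tilde u_--\sqrt{gh},\tilde u_-\bigr),\qquad J_+=\bigl(\tilde u_+,\tilde u_++\sqrt{gh}\bigr],$$ $$R=\Bigl\{z\in\mathbb{C}:\tilde u_-\leq\mathrm{Re}\,z\leq\tilde u_+\text{ and }|\mathrm{Im}\,z|\leq\sqrt{gh}\text{ and }\Bigl|z-\frac{\tilde u_-+\tilde u_+}{2}\Bigr|\leq\frac{\tilde u_+-\tilde u_-}{2}\Bigr\}.$$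
   Context: $g>0$ is a constant; $L^2(I)$ is the space of complex-valued square integrable functions; $\inf_I$ and $\sup_I$ of $L^\infty$ functions are the essential infimum and supremum. $\sigma(A_0)$ is the set of $c\in\mathbb{C}$ such that $A_0-c\mathbf{I}$ is not invertible. *)

theory Defs
  imports "HOL-Analysis.Analysis" "HOL-Probability.Essential_Supremum"
begin

section \<open>Complex normed spaces, bounded operators and their spectrum\<close>

text \<open>
  The library's normed spaces are real. A complex normed space is a real one together with a
  complex scalar multiplication that extends the real one.
\<close>

class complex_normed_vector = real_normed_vector +
  fixes scaleC :: "complex \<Rightarrow> 'a \<Rightarrow> 'a"  (infixr "*\<^sub>C" 75)
  assumes scaleC_add_right: "c *\<^sub>C (x + y) = c *\<^sub>C x + c *\<^sub>C y"
    and scaleC_add_left: "(c + d) *\<^sub>C x = c *\<^sub>C x + d *\<^sub>C x"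
    and scaleC_scaleC: "c *\<^sub>C d *\<^sub>C x = (c * d) *\<^sub>C x"
    and scaleC_of_real: "complex_of_real r *\<^sub>C x = r *\<^sub>R x"
    and norm_scaleC: "norm (c *\<^sub>C x) = cmod c * norm x"

instantiation prod :: (complex_normed_vector, complex_normed_vector) complex_normed_vector
begin

definition scaleC_prod_def: "c *\<^sub>C p = (c *\<^sub>C fst p, c *\<^sub>C snd p)"

instance
proof
  fix c d :: complex and x y :: "'a \<times> 'b" and r :: real
  show "c *\<^sub>C (x + y) = c *\<^sub>C x + c *\<^sub>C y"
    by (simp add: scaleC_prod_def scaleC_add_right)
  show "(c + d) *\<^sub>C x = c *\<^sub>C x + d *\<^sub>C x"
    by (simp add: scaleC_prod_def scaleC_add_left)
  show "c *\<^sub>C d *\<^sub>C x = (c * d) *\<^sub>C x"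
    by (simp add: scaleC_prod_def scaleC_scaleC)
  show "complex_of_real r *\<^sub>C x = r *\<^sub>R x"
    by (simp add: scaleC_prod_def scaleC_of_real scaleR_prod_def)
  show "norm (c *\<^sub>C x) = cmod c * norm x"
    by (simp add: scaleC_prod_def norm_prod_def norm_scaleC power_mult_distrib
        flip: distrib_left) (simp add: real_sqrt_mult)
qed

end

definition bounded_clinear ::
    "('a::complex_normed_vector \<Rightarrow> 'b::complex_normed_vector) \<Rightarrow> bool" where
  "bounded_clinear T \<longleftrightarrow> bounded_linear T \<and> (\<forall>c x. T (c *\<^sub>C x) = c *\<^sub>C T x)"

definition invertible_operator ::
    "('a::complex_normed_vector \<Rightarrow> 'a) \<Rightarrow> bool" where
  "invertible_operator T \<longleftrightarrow> (\<exists>S. bounded_clinear S \<and> S \<circ> T = id \<and> T \<circ> S = id)"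

definition spectrum :: "('a::complex_normed_vector \<Rightarrow> 'a) \<Rightarrow> complex set" where
  "spectrum T = {c. \<not> invertible_operator (\<lambda>x. T x - c *\<^sub>C x)}"


section \<open>Function spaces on the unit interval\<close>

abbreviation leb_I :: "real measure" where
  "leb_I \<equiv> lebesgue_on {0<..<1}"

definition square_integrable_I :: "(real \<Rightarrow> complex) \<Rightarrow> bool" where
  "square_integrable_I f \<longleftrightarrow>
     f \<in> borel_measurable leb_I \<and> integrable leb_I (\<lambda>x. (cmod (f x))\<^sup>2)"

lemma square_integrable_I_measurable:
  "square_integrable_I f \<Longrightarrow> f \<in> borel_measurable leb_I"
  by (simp add: square_integrable_I_def)

lemma square_integrable_I_zero: "square_integrable_I (\<lambda>x. 0)"
  by (simp add: square_integrable_I_def)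

lemma finite_measure_leb_I: "finite_measure leb_I"
  by (rule finite_measure_lebesgue_on) (simp add: bounded_set_imp_lmeasurable)

lemma measure_leb_I: "measure leb_I (space leb_I) = 1"
  by (simp add: measure_restrict_space)

lemma square_integrable_I_const: "square_integrable_I (\<lambda>x. c)"
  unfolding square_integrable_I_def
  using finite_measure.integrable_const[OF finite_measure_leb_I] by auto

lemma square_integrable_I_scale:
  "square_integrable_I f \<Longrightarrow> square_integrable_I (\<lambda>x. c * f x)"
  by (auto simp: square_integrable_I_def norm_mult power_mult_distrib)

lemma borel_measurable_cnj [measurable]: "cnj \<in> borel_measurable borel"
  by (intro borel_measurable_continuous_onI continuous_intros)

lemma square_integrable_I_add:
  assumes f: "square_integrable_I f" and g: "square_integrable_I g"
  shows "square_integrable_I (\<lambda>x. f x + g x)"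
proof -
  have [measurable]: "f \<in> borel_measurable leb_I" "g \<in> borel_measurable leb_I"
    using f g by (auto simp: square_integrable_I_def)
  have "integrable leb_I (\<lambda>x. (cmod (f x + g x))\<^sup>2)"
  proof (rule Bochner_Integration.integrable_bound)
    show "integrable leb_I (\<lambda>x. 2 * (cmod (f x))\<^sup>2 + 2 * (cmod (g x))\<^sup>2)"
      using f g by (auto simp: square_integrable_I_def)
    show "(\<lambda>x. (cmod (f x + g x))\<^sup>2) \<in> borel_measurable leb_I"
      by measurable
    have "(cmod (f x + g x))\<^sup>2 \<le> 2 * (cmod (f x))\<^sup>2 + 2 * (cmod (g x))\<^sup>2" for x
    proof -
      have "(cmod (f x + g x))\<^sup>2 \<le> (cmod (f x) + cmod (g x))\<^sup>2"
        by (intro power_mono norm_triangle_ineq) auto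
      also have "\<dots> \<le> 2 * (cmod (f x))\<^sup>2 + 2 * (cmod (g x))\<^sup>2"
        using sum_squares_bound[of "cmod (f x)" "cmod (g x)"]
        by (simp add: power2_eq_square algebra_simps)
      finally show ?thesis .
    qed
    then show "AE x in leb_I. norm ((cmod (f x + g x))\<^sup>2)
        \<le> norm (2 * (cmod (f x))\<^sup>2 + 2 * (cmod (g x))\<^sup>2)"
      by auto
  qed
  then show ?thesis
    by (simp add: square_integrable_I_def)
qed

lemma square_integrable_I_prod:
  assumes f: "square_integrable_I f" and g: "square_integrable_I g"
  shows "integrable leb_I (\<lambda>x. f x * cnj (g x))"
proof (rule Bochner_Integration.integrable_bound)
  have [measurable]: "f \<in> borel_measurable leb_I" "g \<in> borel_measurable leb_I"
    using f g by (auto simp: square_integrable_I_def)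
  show "integrable leb_I (\<lambda>x. (cmod (f x))\<^sup>2 + (cmod (g x))\<^sup>2)"
    using f g by (auto simp: square_integrable_I_def)
  show "(\<lambda>x. f x * cnj (g x)) \<in> borel_measurable leb_I"
    by measurable
  have "cmod (f x) * cmod (g x) \<le> (cmod (f x))\<^sup>2 + (cmod (g x))\<^sup>2" for x
  proof -
    have "0 \<le> cmod (f x) * cmod (g x)" by simp
    with sum_squares_bound[of "cmod (f x)" "cmod (g x)"] show ?thesis by linarith
  qed
  then show "AE x in leb_I. norm (f x * cnj (g x))
      \<le> norm ((cmod (f x))\<^sup>2 + (cmod (g x))\<^sup>2)"
    by (auto simp: norm_mult)
qed

lemma square_integrable_I_integrable:
  "square_integrable_I f \<Longrightarrow> integrable leb_I f"
  using square_integrable_I_prod[OF _ square_integrable_I_const[of 1]] by simp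

text \<open>The space \<open>L\<^sup>2(I)\<close>: square integrable functions modulo equality almost everywhere.\<close>

definition L2_rel :: "(real \<Rightarrow> complex) \<Rightarrow> (real \<Rightarrow> complex) \<Rightarrow> bool" where
  "L2_rel f g \<longleftrightarrow>
     square_integrable_I f \<and> square_integrable_I g \<and> (AE x in leb_I. f x = g x)"

quotient_type L2I = "real \<Rightarrow> complex" / partial: L2_rel
  morphisms rep_L2I abs_L2I
proof (rule part_equivpI)
  show "\<exists>f. L2_rel f f"
    using square_integrable_I_zero by (auto simp: L2_rel_def)
  show "symp L2_rel"
    by (auto simp: symp_def L2_rel_def elim: eventually_mono)
  show "transp L2_rel"
    unfolding transp_def L2_rel_def by (auto elim: eventually_elim2)
qed

instantiation L2I :: real_inner
begin

lift_definition zero_L2I :: L2I is "\<lambda>x. 0"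
  by (simp add: L2_rel_def square_integrable_I_zero)

lift_definition plus_L2I :: "L2I \<Rightarrow> L2I \<Rightarrow> L2I" is "\<lambda>f g x. f x + g x"
  unfolding L2_rel_def by (auto intro: square_integrable_I_add elim: eventually_elim2)

lift_definition uminus_L2I :: "L2I \<Rightarrow> L2I" is "\<lambda>f x. - f x"
  unfolding L2_rel_def
  by (auto simp: square_integrable_I_def elim: eventually_mono)

definition minus_L2I :: "L2I \<Rightarrow> L2I \<Rightarrow> L2I" where
  "minus_L2I \<phi> \<psi> = \<phi> + - \<psi>"

lift_definition scaleR_L2I :: "real \<Rightarrow> L2I \<Rightarrow> L2I" is "\<lambda>r f x. complex_of_real r * f x"
  unfolding L2_rel_def by (auto intro: square_integrable_I_scale elim: eventually_mono)

text \<open>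
  The real part of the usual Hermitian inner product; it induces the same norm.
\<close>

lift_definition inner_L2I :: "L2I \<Rightarrow> L2I \<Rightarrow> real" is
  "\<lambda>f g. Re (\<integral>x. f x * cnj (g x) \<partial>leb_I)"
proof -
  fix f f' g g' assume "L2_rel f f'" "L2_rel g g'"
  then have [measurable]: "f \<in> borel_measurable leb_I" "g \<in> borel_measurable leb_I"
      "f' \<in> borel_measurable leb_I" "g' \<in> borel_measurable leb_I"
    and "AE x in leb_I. f x = f' x" "AE x in leb_I. g x = g' x"
    by (auto simp: square_integrable_I_def L2_rel_def)
  then have "AE x in leb_I. f x * cnj (g x) = f' x * cnj (g' x)"
    by (auto elim: eventually_elim2)
  then have "(\<integral>x. f x * cnj (g x) \<partial>leb_I) = (\<integral>x. f' x * cnj (g' x) \<partial>leb_I)"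
    by (intro integral_cong_AE) measurable
  then show "Re (\<integral>x. f x * cnj (g x) \<partial>leb_I) = Re (\<integral>x. f' x * cnj (g' x) \<partial>leb_I)"
    by simp
qed

lift_definition norm_L2I :: "L2I \<Rightarrow> real" is
  "\<lambda>f. sqrt (\<integral>x. (cmod (f x))\<^sup>2 \<partial>leb_I)"
proof -
  fix f f' assume "L2_rel f f'"
  then have [measurable]: "f \<in> borel_measurable leb_I" "f' \<in> borel_measurable leb_I"
    and "AE x in leb_I. f x = f' x"
    by (auto simp: square_integrable_I_def L2_rel_def)
  then have "AE x in leb_I. (cmod (f x))\<^sup>2 = (cmod (f' x))\<^sup>2"
    by (auto elim: eventually_mono)
  then have "(\<integral>x. (cmod (f x))\<^sup>2 \<partial>leb_I) = (\<integral>x. (cmod (f' x))\<^sup>2 \<partial>leb_I)"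
    by (intro integral_cong_AE) measurable
  then show "sqrt (\<integral>x. (cmod (f x))\<^sup>2 \<partial>leb_I) = sqrt (\<integral>x. (cmod (f' x))\<^sup>2 \<partial>leb_I)"
    by simp
qed

definition dist_L2I :: "L2I \<Rightarrow> L2I \<Rightarrow> real" where
  "dist_L2I \<phi> \<psi> = norm (\<phi> - \<psi>)"

definition sgn_L2I :: "L2I \<Rightarrow> L2I" where
  "sgn_L2I \<phi> = inverse (norm \<phi>) *\<^sub>R \<phi>"

definition uniformity_L2I :: "(L2I \<times> L2I) filter" where
  "uniformity_L2I = (INF e\<in>{0 <..}. principal {(\<phi>, \<psi>). dist \<phi> \<psi> < e})"

definition open_L2I :: "L2I set \<Rightarrow> bool" where
  "open_L2I U = (\<forall>\<phi>\<in>U. eventually (\<lambda>(\<phi>', \<psi>). \<phi>' = \<phi> \<longrightarrow> \<psi> \<in> U) uniformity)"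

instance
proof
  fix x y z :: L2I and r s :: real and U :: "L2I set"
  show "x + y + z = x + (y + z)"
    by transfer (auto simp: L2_rel_def add.assoc intro!: square_integrable_I_add)
  show "x + y = y + x"
    by transfer (auto simp: L2_rel_def add.commute intro!: square_integrable_I_add)
  show "0 + x = x"
    by transfer (auto simp: L2_rel_def)
  show "- x + x = 0"
    by transfer (auto simp: L2_rel_def square_integrable_I_zero)
  show "x - y = x + - y"
    by (rule minus_L2I_def)
  show "r *\<^sub>R (x + y) = r *\<^sub>R x + r *\<^sub>R y"
    by transfer (auto simp: L2_rel_def ring_distribs
        intro!: square_integrable_I_add square_integrable_I_scale)
  show "(r + s) *\<^sub>R x = r *\<^sub>R x + s *\<^sub>R x"
    by transfer (auto simp: L2_rel_def ring_distribs
        intro!: square_integrable_I_add square_integrable_I_scale)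
  show "r *\<^sub>R s *\<^sub>R x = (r * s) *\<^sub>R x"
    by transfer (auto simp: L2_rel_def mult.assoc intro!: square_integrable_I_scale)
  show "1 *\<^sub>R x = x"
    by transfer (auto simp: L2_rel_def)
  show "dist x y = norm (x - y)"
    by (rule dist_L2I_def)
  show "sgn x = inverse (norm x) *\<^sub>R x"
    by (rule sgn_L2I_def)
  show "uniformity = (INF e\<in>{0 <..}. principal {(\<phi>, \<psi>::L2I). dist \<phi> \<psi> < e})"
    by (rule uniformity_L2I_def)
  show "open U = (\<forall>x\<in>U. \<forall>\<^sub>F (x', y) in uniformity. x' = x \<longrightarrow> y \<in> U)"
    by (rule open_L2I_def)
  show "x \<bullet> y = y \<bullet> x"
  proof transfer
    fix f g
    have "(\<integral>x. f x * cnj (g x) \<partial>leb_I) = (\<integral>x. cnj (g x * cnj (f x)) \<partial>leb_I)"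
      by (simp add: mult.commute)
    also have "\<dots> = cnj (\<integral>x. g x * cnj (f x) \<partial>leb_I)"
      by (rule Bochner_Integration.integral_cnj)
    finally show "Re (\<integral>x. f x * cnj (g x) \<partial>leb_I) = Re (\<integral>x. g x * cnj (f x) \<partial>leb_I)"
      by simp
  qed
  show "(x + y) \<bullet> z = x \<bullet> z + y \<bullet> z"
    by transfer (simp add: L2_rel_def ring_distribs square_integrable_I_prod)
  show "(r *\<^sub>R x) \<bullet> y = r * (x \<bullet> y)"
    by transfer (simp add: mult.assoc)
  have sq: "Re (\<integral>x. f x * cnj (f x) \<partial>leb_I) = (\<integral>x. (cmod (f x))\<^sup>2 \<partial>leb_I)" for f
  proof -
    have "(\<integral>x. f x * cnj (f x) \<partial>leb_I) = (\<integral>x. complex_of_real ((cmod (f x))\<^sup>2) \<partial>leb_I)"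
      by (simp add: complex_norm_square del: of_real_power)
    then show ?thesis
      by (simp del: of_real_power)
  qed
  show "0 \<le> x \<bullet> x"
    by transfer (simp add: sq)
  show "x \<bullet> x = 0 \<longleftrightarrow> x = 0"
    by transfer (auto simp: sq L2_rel_def square_integrable_I_zero square_integrable_I_def
        integral_nonneg_eq_0_iff_AE)
  show "norm x = sqrt (x \<bullet> x)"
    by transfer (simp add: sq)
qed

end

instantiation L2I :: complex_normed_vector
begin

lift_definition scaleC_L2I :: "complex \<Rightarrow> L2I \<Rightarrow> L2I" is "\<lambda>c f x. c * f x"
  unfolding L2_rel_def by (auto intro: square_integrable_I_scale elim: eventually_mono)

instance
proof
  fix x y :: L2I and r :: real and c d :: complex
  show "c *\<^sub>C (x + y) = c *\<^sub>C x + c *\<^sub>C y"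
    by transfer (auto simp: L2_rel_def ring_distribs
        intro!: square_integrable_I_add square_integrable_I_scale)
  show "(c + d) *\<^sub>C x = c *\<^sub>C x + d *\<^sub>C x"
    by transfer (auto simp: L2_rel_def ring_distribs
        intro!: square_integrable_I_add square_integrable_I_scale)
  show "c *\<^sub>C d *\<^sub>C x = (c * d) *\<^sub>C x"
    by transfer (auto simp: L2_rel_def mult.assoc intro!: square_integrable_I_scale)
  show "complex_of_real r *\<^sub>C x = r *\<^sub>R x"
    by transfer (auto simp: L2_rel_def intro!: square_integrable_I_scale)
  show "norm (c *\<^sub>C x) = cmod c * norm x"
    by transfer (simp add: norm_mult power_mult_distrib real_sqrt_mult)
qed

end

text \<open>
  Elements of \<open>L\<^sup>\<infinity>(I)\<close> are given by real-valued representatives; the operations below do not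
  depend on the choice of the representative.
\<close>

definition Linf_I :: "(real \<Rightarrow> real) set" where
  "Linf_I = {u \<in> borel_measurable leb_I. esssup leb_I (\<lambda>x. ereal \<bar>u x\<bar>) < \<infinity>}"

definition ess_sup_I :: "(real \<Rightarrow> real) \<Rightarrow> real" where
  "ess_sup_I u = real_of_ereal (esssup leb_I (\<lambda>x. ereal (u x)))"

definition ess_inf_I :: "(real \<Rightarrow> real) \<Rightarrow> real" where
  "ess_inf_I u = - ess_sup_I (\<lambda>x. - u x)"

lemma Linf_I_iff:
  "u \<in> Linf_I \<longleftrightarrow> u \<in> borel_measurable leb_I \<and> (\<exists>K\<ge>0. AE x in leb_I. \<bar>u x\<bar> \<le> K)"
proof (cases "u \<in> borel_measurable leb_I")
  case m[measurable]: True
  show ?thesis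
  proof
    assume "u \<in> Linf_I"
    then have lt: "esssup leb_I (\<lambda>x. ereal \<bar>u x\<bar>) < \<infinity>"
      by (simp add: Linf_I_def)
    have "\<exists>r. esssup leb_I (\<lambda>x. ereal \<bar>u x\<bar>) \<le> ereal r"
      using lt by (cases "esssup leb_I (\<lambda>x. ereal \<bar>u x\<bar>)") auto
    then obtain r where r: "esssup leb_I (\<lambda>x. ereal \<bar>u x\<bar>) \<le> ereal r" by auto
    have "AE x in leb_I. \<bar>u x\<bar> \<le> max r 0"
      using esssup_AE[of "\<lambda>x. ereal \<bar>u x\<bar>" leb_I]
    proof eventually_elim
      case (elim x)
      then have "ereal \<bar>u x\<bar> \<le> ereal r" using r by (rule order_trans)
      then show ?case by simp
    qed
    then show "u \<in> borel_measurable leb_I \<and> (\<exists>K\<ge>0. AE x in leb_I. \<bar>u x\<bar> \<le> K)"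
      using m by (intro conjI exI[of _ "max r 0"]) auto
  next
    assume "u \<in> borel_measurable leb_I \<and> (\<exists>K\<ge>0. AE x in leb_I. \<bar>u x\<bar> \<le> K)"
    then obtain K where K: "AE x in leb_I. \<bar>u x\<bar> \<le> K" by auto
    have "esssup leb_I (\<lambda>x. ereal \<bar>u x\<bar>) \<le> ereal K"
      using K by (intro esssup_I) auto
    then show "u \<in> Linf_I"
      using m by (auto simp: Linf_I_def intro: le_less_trans)
  qed
qed (simp add: Linf_I_def)

lemma Linf_I_uminus: "u \<in> Linf_I \<Longrightarrow> (\<lambda>x. - u x) \<in> Linf_I"
  by (auto simp: Linf_I_iff)

lemma ess_sup_I_finite:
  assumes "u \<in> Linf_I"
  shows "esssup leb_I (\<lambda>x. ereal (u x)) = ereal (ess_sup_I u)"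
proof -
  have [measurable]: "u \<in> borel_measurable leb_I"
    using assms by (simp add: Linf_I_iff)
  obtain K where K: "AE x in leb_I. \<bar>u x\<bar> \<le> K"
    using assms by (auto simp: Linf_I_iff)
  have nz: "emeasure leb_I (space leb_I) \<noteq> 0"
    using measure_leb_I by (auto simp: measure_def)
  have "esssup leb_I (\<lambda>x. ereal (u x)) \<le> ereal K"
    using K by (intro esssup_I) (auto elim: eventually_mono)
  moreover have "ereal (- K) \<le> esssup leb_I (\<lambda>x. ereal (u x))"
  proof -
    have "ereal (- K) = esssup leb_I (\<lambda>x. ereal (- K))"
      by (rule esssup_const[OF nz, symmetric])
    also have "\<dots> \<le> esssup leb_I (\<lambda>x. ereal (u x))"
      using K by (intro esssup_AE_mono) (auto elim: eventually_mono)
    finally show ?thesis .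
  qed
  ultimately show ?thesis
    unfolding ess_sup_I_def
    by (cases "esssup leb_I (\<lambda>x. ereal (u x))") auto
qed

lemma ess_sup_I_le_iff:
  assumes "u \<in> Linf_I"
  shows "ess_sup_I u \<le> c \<longleftrightarrow> (AE x in leb_I. u x \<le> c)"
proof
  have [measurable]: "u \<in> borel_measurable leb_I"
    using assms by (simp add: Linf_I_iff)
  show "AE x in leb_I. u x \<le> c" if "ess_sup_I u \<le> c"
    using esssup_AE[of "\<lambda>x. ereal (u x)" leb_I] that
    unfolding ess_sup_I_finite[OF assms] by (auto elim: eventually_mono)
  show "ess_sup_I u \<le> c" if "AE x in leb_I. u x \<le> c"
  proof -
    have "esssup leb_I (\<lambda>x. ereal (u x)) \<le> ereal c"
      using that by (intro esssup_I) auto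
    then show ?thesis
      unfolding ess_sup_I_finite[OF assms] by simp
  qed
qed

lemma le_ess_inf_I_iff:
  assumes "u \<in> Linf_I"
  shows "c \<le> ess_inf_I u \<longleftrightarrow> (AE x in leb_I. c \<le> u x)"
  using ess_sup_I_le_iff[OF Linf_I_uminus[OF assms], of "- c"]
  by (auto simp: ess_inf_I_def)


section \<open>The operator\<close>

text \<open>
  Pointwise multiplication by \<open>u\<close>, which is well defined on \<open>L\<^sup>2(I)\<close> for \<open>u\<close> in \<open>L\<^sup>\<infinity>(I)\<close>; see
  \<open>mult_I_abs\<close>. For other \<open>u\<close> the value is meaningless.
\<close>

definition mult_I :: "(real \<Rightarrow> real) \<Rightarrow> L2I \<Rightarrow> L2I" where
  "mult_I u \<phi> = abs_L2I (\<lambda>x. complex_of_real (u x) * rep_L2I \<phi> x)"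

lift_definition integral_I :: "L2I \<Rightarrow> complex" is "\<lambda>f. \<integral>x. f x \<partial>leb_I"
  unfolding L2_rel_def square_integrable_I_def by (auto intro!: integral_cong_AE)

lift_definition const_I :: "complex \<Rightarrow> L2I" is "\<lambda>c x. c"
  by (simp add: L2_rel_def square_integrable_I_const)

definition A0 ::
    "real \<Rightarrow> (real \<Rightarrow> real) \<Rightarrow> (real \<Rightarrow> real) \<Rightarrow> L2I \<times> L2I \<Rightarrow> L2I \<times> L2I" where
  "A0 g u H = (\<lambda>(\<phi>\<^sub>1, \<phi>\<^sub>2).
     (mult_I u \<phi>\<^sub>1 + mult_I H \<phi>\<^sub>2,
      const_I (complex_of_real g * integral_I \<phi>\<^sub>1) + mult_I u \<phi>\<^sub>2))"

lemma square_integrable_I_mult: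
  assumes u: "u \<in> Linf_I" and f: "square_integrable_I f"
  shows "square_integrable_I (\<lambda>x. complex_of_real (u x) * f x)"
proof -
  have [measurable]: "u \<in> borel_measurable leb_I" "f \<in> borel_measurable leb_I"
    using u f by (auto simp: Linf_I_iff square_integrable_I_def)
  obtain K where K: "AE x in leb_I. \<bar>u x\<bar> \<le> K"
    using u by (auto simp: Linf_I_iff)
  have "integrable leb_I (\<lambda>x. (cmod (complex_of_real (u x) * f x))\<^sup>2)"
  proof (rule Bochner_Integration.integrable_bound)
    show "integrable leb_I (\<lambda>x. K\<^sup>2 * (cmod (f x))\<^sup>2)"
      using f by (auto simp: square_integrable_I_def)
    show "AE x in leb_I. norm ((cmod (complex_of_real (u x) * f x))\<^sup>2)
        \<le> norm (K\<^sup>2 * (cmod (f x))\<^sup>2)"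
      using K
    proof eventually_elim
      case (elim x)
      then have "\<bar>u x\<bar>\<^sup>2 \<le> K\<^sup>2" by (intro power_mono) auto
      then show ?case by (auto simp: norm_mult power_mult_distrib intro!: mult_right_mono)
    qed
  qed measurable
  then show ?thesis
    by (simp add: square_integrable_I_def)
qed

lemma square_integrable_rep_L2I: "square_integrable_I (rep_L2I \<phi>)"
  using Quotient3_rep_reflp[OF Quotient3_L2I] by (auto simp: L2_rel_def)

lemma abs_L2I_eq_iff:
  assumes "square_integrable_I f" "square_integrable_I f'"
  shows "abs_L2I f = abs_L2I f' \<longleftrightarrow> (AE x in leb_I. f x = f' x)"
  using Quotient3_rel[OF Quotient3_L2I, of f f'] assms by (auto simp: L2_rel_def)

lemma abs_rep_L2I: "abs_L2I (rep_L2I \<phi>) = \<phi>"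
  by (rule Quotient3_abs_rep[OF Quotient3_L2I])

lemma L2I_cases:
  obtains f where "square_integrable_I f" "\<phi> = abs_L2I f"
  using square_integrable_rep_L2I abs_rep_L2I by metis

lemma mult_I_abs:
  assumes u: "u \<in> Linf_I" and f: "square_integrable_I f"
  shows "mult_I u (abs_L2I f) = abs_L2I (\<lambda>x. complex_of_real (u x) * f x)"
proof -
  have "AE x in leb_I. rep_L2I (abs_L2I f) x = f x"
    using abs_L2I_eq_iff[OF square_integrable_rep_L2I f] abs_rep_L2I by blast
  then show ?thesis
    unfolding mult_I_def
    by (subst abs_L2I_eq_iff)
      (auto intro: square_integrable_I_mult[OF u] square_integrable_rep_L2I f elim: eventually_mono)
qed

lemma L2_rel_refl: "square_integrable_I f \<Longrightarrow> L2_rel f f"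
  by (simp add: L2_rel_def)

lemma bounded_clinearI:
  assumes "\<And>x y. T (x + y) = T x + T y" "\<And>c x. T (c *\<^sub>C x) = c *\<^sub>C T x"
    and "\<And>x. norm (T x) \<le> norm x * K"
  shows "bounded_clinear T"
  unfolding bounded_clinear_def
  using assms by (auto intro!: bounded_linear_intro simp flip: scaleC_of_real)

lemma bounded_clinear_mult_I:
  assumes u: "u \<in> Linf_I"
  shows "bounded_clinear (mult_I u)"
proof -
  obtain K where K0: "0 \<le> K" and K: "AE x in leb_I. \<bar>u x\<bar> \<le> K"
    using u by (auto simp: Linf_I_iff)
  show ?thesis
  proof (rule bounded_clinearI)
    fix \<phi> \<psi> :: L2I and c :: complex
    obtain f where f: "square_integrable_I f" "\<phi> = abs_L2I f" by (rule L2I_cases)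
    obtain f' where f': "square_integrable_I f'" "\<psi> = abs_L2I f'" by (rule L2I_cases)
    show "mult_I u (\<phi> + \<psi>) = mult_I u \<phi> + mult_I u \<psi>"
      using f f' by (simp add: plus_L2I.abs_eq L2_rel_refl mult_I_abs[OF u] ring_distribs
          square_integrable_I_mult[OF u] square_integrable_I_add)
    show "mult_I u (c *\<^sub>C \<phi>) = c *\<^sub>C mult_I u \<phi>"
      using f by (simp add: scaleC_L2I.abs_eq L2_rel_refl mult_I_abs[OF u]
          square_integrable_I_mult[OF u] square_integrable_I_scale mult.left_commute)
    have "(\<integral>x. (cmod (complex_of_real (u x) * f x))\<^sup>2 \<partial>leb_I)
        \<le> (\<integral>x. K\<^sup>2 * (cmod (f x))\<^sup>2 \<partial>leb_I)"
    proof (rule integral_mono_AE)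
      show "integrable leb_I (\<lambda>x. (cmod (complex_of_real (u x) * f x))\<^sup>2)"
        using square_integrable_I_mult[OF u f(1)] by (simp add: square_integrable_I_def)
      show "integrable leb_I (\<lambda>x. K\<^sup>2 * (cmod (f x))\<^sup>2)"
        using f by (simp add: square_integrable_I_def)
      show "AE x in leb_I. (cmod (complex_of_real (u x) * f x))\<^sup>2 \<le> K\<^sup>2 * (cmod (f x))\<^sup>2"
        using K
      proof eventually_elim
        case (elim x)
        then have "\<bar>u x\<bar>\<^sup>2 \<le> K\<^sup>2" by (intro power_mono) auto
        then show ?case by (auto simp: norm_mult power_mult_distrib intro!: mult_right_mono)
      qed
    qed
    then have "sqrt (\<integral>x. (cmod (complex_of_real (u x) * f x))\<^sup>2 \<partial>leb_I)
        \<le> sqrt (K\<^sup>2 * (\<integral>x. (cmod (f x))\<^sup>2 \<partial>leb_I))"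
      by simp
    then show "norm (mult_I u \<phi>) \<le> norm \<phi> * K"
      using K0 norm_L2I.abs_eq[OF L2_rel_refl[OF square_integrable_I_mult[OF u f(1)]]]
        norm_L2I.abs_eq[OF L2_rel_refl[OF f(1)]]
      by (simp add: f(2) mult_I_abs[OF u f(1)] real_sqrt_mult mult.commute)
  qed
qed

lemma integral_I_eq_inner:
  "integral_I \<phi> = Complex (\<phi> \<bullet> const_I 1) (\<phi> \<bullet> const_I \<i>)"
proof transfer
  fix f assume "L2_rel f f"
  then have "integrable leb_I f"
    by (simp add: L2_rel_def square_integrable_I_integrable)
  then show "integral\<^sup>L leb_I f
      = Complex (Re (\<integral>x. f x * cnj 1 \<partial>leb_I)) (Re (\<integral>x. f x * cnj \<i> \<partial>leb_I))"
    by (simp add: complex_eq_iff)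
qed

lemma norm_const_I: "norm (const_I c) = cmod c"
  by transfer (simp add: measure_restrict_space)

lemma const_I_add: "const_I (c + d) = const_I c + const_I d"
  by transfer (simp add: L2_rel_def square_integrable_I_const)

lemma const_I_mult: "const_I (c * d) = c *\<^sub>C const_I d"
  by transfer (simp add: L2_rel_def square_integrable_I_const)

lemma integral_I_add: "integral_I (\<phi> + \<psi>) = integral_I \<phi> + integral_I \<psi>"
  by transfer (simp add: L2_rel_def square_integrable_I_integrable)

lemma integral_I_scaleC: "integral_I (c *\<^sub>C \<phi>) = c * integral_I \<phi>"
  by transfer simp

lemma norm_integral_I_le: "cmod (integral_I \<phi>) \<le> 2 * norm \<phi>"
proof -
  have "cmod (integral_I \<phi>) \<le> \<bar>\<phi> \<bullet> const_I 1\<bar> + \<bar>\<phi> \<bullet> const_I \<i>\<bar>"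
    using cmod_le[of "integral_I \<phi>"] by (simp add: integral_I_eq_inner)
  also have "\<dots> \<le> 2 * norm \<phi>"
    using Cauchy_Schwarz_ineq2[of \<phi> "const_I 1"] Cauchy_Schwarz_ineq2[of \<phi> "const_I \<i>"]
    by (simp add: norm_const_I)
  finally show ?thesis .
qed

lemma bounded_clinear_A0:
  assumes u: "u \<in> Linf_I" and H: "H \<in> Linf_I"
  shows "bounded_clinear (A0 g u H)"
proof -
  have mu: "bounded_linear (mult_I u)" and mH: "bounded_linear (mult_I H)"
    and cu: "mult_I u (c *\<^sub>C \<phi>) = c *\<^sub>C mult_I u \<phi>"
    and cH: "mult_I H (c *\<^sub>C \<phi>) = c *\<^sub>C mult_I H \<phi>" for c \<phi>
    using bounded_clinear_mult_I[OF u] bounded_clinear_mult_I[OF H]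
    by (auto simp: bounded_clinear_def)
  have m: "bounded_linear (\<lambda>\<phi>. const_I (complex_of_real g * integral_I \<phi>))"
  proof (rule bounded_linear_intro)
    fix \<phi> \<psi> :: L2I and r :: real
    show "const_I (complex_of_real g * integral_I (\<phi> + \<psi>))
        = const_I (complex_of_real g * integral_I \<phi>) + const_I (complex_of_real g * integral_I \<psi>)"
      by (simp add: integral_I_add ring_distribs const_I_add)
    show "const_I (complex_of_real g * integral_I (r *\<^sub>R \<phi>))
        = r *\<^sub>R const_I (complex_of_real g * integral_I \<phi>)"
      by (simp add: integral_I_scaleC mult.left_commute flip: scaleC_of_real const_I_mult)
    have "\<bar>g\<bar> * cmod (integral_I \<phi>) \<le> \<bar>g\<bar> * (2 * norm \<phi>)"
      by (intro mult_left_mono norm_integral_I_le) auto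
    then show "norm (const_I (complex_of_real g * integral_I \<phi>)) \<le> norm \<phi> * (2 * \<bar>g\<bar>)"
      by (simp add: norm_const_I norm_mult algebra_simps)
  qed
  have A0_eq: "A0 g u H = (\<lambda>p. (mult_I u (fst p) + mult_I H (snd p),
      const_I (complex_of_real g * integral_I (fst p)) + mult_I u (snd p)))"
    by (auto simp: A0_def fun_eq_iff)
  have "bounded_linear (A0 g u H)"
    unfolding A0_eq
    by (intro bounded_linear_Pair bounded_linear_add
        bounded_linear_compose[OF mu bounded_linear_fst]
        bounded_linear_compose[OF mu bounded_linear_snd]
        bounded_linear_compose[OF mH bounded_linear_snd]
        bounded_linear_compose[OF m bounded_linear_fst])
  moreover have "A0 g u H (c *\<^sub>C p) = c *\<^sub>C A0 g u H p" for c p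
    by (simp add: A0_eq scaleC_prod_def cu cH integral_I_scaleC scaleC_add_right
        mult.left_commute flip: const_I_mult)
  ultimately show ?thesis
    by (simp add: bounded_clinear_def)
qed

end

theory Submission
  imports Defs
begin

text \<open>
  If \<open>c\<close> lies off the segment \<open>[u\<^sub>-, u\<^sub>+]\<close>, then \<open>k = 1 / (u - c)\<close> is bounded, and solving
  \<open>(A\<^sub>0 - c) \<phi> = \<psi>\<close> by elimination leaves one scalar equation for \<open>\<integral>\<phi>\<^sub>1\<close> with coefficient
  \<open>1 - g \<integral>H k\<^sup>2\<close>. So \<open>c\<close> is spectral only if \<open>g \<integral>H / (u - c)\<^sup>2 = 1\<close>. For real \<open>c\<close> and for the
  bound on \<open>Im c\<close>, estimate the integrand. For \<open>c = a + \<i>b\<close> with \<open>b \<noteq> 0\<close>, put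
  \<open>w = H / \<bar>u - c\<bar>\<^sup>4 > 0\<close>; the real and imaginary parts of the equation say
  \<open>g \<integral>w ((u - a)\<^sup>2 - b\<^sup>2) = 1\<close> and \<open>\<integral>w (u - a) = 0\<close>. The latter forces \<open>u\<^sub>- \<le> a \<le> u\<^sub>+\<close>, and
  integrating \<open>w (u - u\<^sub>-) (u - u\<^sub>+) \<le> 0\<close> gives the semicircle bound, as in Howard's theorem.
\<close>

section \<open>Bounded complex-linear operators\<close>

lemma bounded_clinear_compose:
  "bounded_clinear S \<Longrightarrow> bounded_clinear T \<Longrightarrow> bounded_clinear (\<lambda>x. S (T x))"
  by (auto simp: bounded_clinear_def intro: bounded_linear_compose)

lemma bounded_clinear_add:
  "bounded_clinear S \<Longrightarrow> bounded_clinear T \<Longrightarrow> bounded_clinear (\<lambda>x. S x + T x)"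
  by (auto simp: bounded_clinear_def scaleC_add_right intro: bounded_linear_add)

lemma bounded_clinear_scaleC: "bounded_clinear (\<lambda>x. c *\<^sub>C x)"
proof (rule bounded_clinearI)
  show "norm (c *\<^sub>C x) \<le> norm x * cmod c" for x :: 'a
    by (simp add: norm_scaleC)
qed (simp_all add: scaleC_add_right scaleC_scaleC mult.commute)

lemma scaleC_minus_one: "(-1) *\<^sub>C x = - x"
  using scaleC_of_real[of "-1" x] by simp

lemma bounded_clinear_diff:
  assumes "bounded_clinear S" "bounded_clinear T"
  shows "bounded_clinear (\<lambda>x. S x - T x)"
  using bounded_clinear_add[OF assms(1)
      bounded_clinear_compose[OF bounded_clinear_scaleC assms(2), of "-1"]]
  by (simp add: scaleC_minus_one)

lemma bounded_clinear_Pair: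
  "bounded_clinear S \<Longrightarrow> bounded_clinear T \<Longrightarrow> bounded_clinear (\<lambda>x. (S x, T x))"
  by (auto simp: bounded_clinear_def scaleC_prod_def intro: bounded_linear_Pair)

lemma bounded_clinear_fst: "bounded_clinear fst"
  and bounded_clinear_snd: "bounded_clinear snd"
  by (auto simp: bounded_clinear_def scaleC_prod_def bounded_linear_fst bounded_linear_snd)

lemma clinear_simps:
  assumes "bounded_clinear T"
  shows "T (x + y) = T x + T y" "T (x - y) = T x - T y" "T (c *\<^sub>C x) = c *\<^sub>C T x"
  using assms by (auto simp: bounded_clinear_def linear_simps)

lemma scaleC_simps:
  "c *\<^sub>C (x - y) = c *\<^sub>C x - c *\<^sub>C y" "(c - d) *\<^sub>C x = c *\<^sub>C x - d *\<^sub>C x" "1 *\<^sub>C x = x"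
proof -
  show "c *\<^sub>C (x - y) = c *\<^sub>C x - c *\<^sub>C y"
    by (rule clinear_simps(2)[OF bounded_clinear_scaleC])
  show "(c - d) *\<^sub>C x = c *\<^sub>C x - d *\<^sub>C x"
    using scaleC_add_left[of "c - d" d x] by (simp add: algebra_simps)
  show "1 *\<^sub>C x = x"
    using scaleC_of_real[of 1 x] by simp
qed

text \<open>The integral is kept as a constant function: the coupling term of \<open>A0\<close> is
  then \<open>g\<close> times a bounded map of \<open>L2I\<close> to itself, and the elimination
  below needs no scalar unknowns.\<close>

definition mean_I :: "L2I \<Rightarrow> L2I" where
  "mean_I \<phi> = const_I (integral_I \<phi>)"

lemma bounded_clinear_mean_I: "bounded_clinear mean_I"
proof (rule bounded_clinearI)
  show "norm (mean_I \<phi>) \<le> norm \<phi> * 2" for \<phi>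
    using norm_integral_I_le[of \<phi>] by (simp add: mean_I_def norm_const_I mult.commute)
qed (simp_all add: mean_I_def integral_I_add const_I_add integral_I_scaleC const_I_mult)

section \<open>The inverse of \<open>A0 g u H - c\<close> by elimination\<close>

text \<open>
  \<open>K\<close> stands for multiplication by \<open>1 / (u - c)\<close>. The constant function \<open>\<integral>\<phi>\<^sub>1\<close> is recovered
  from \<open>\<psi>\<close> as \<open>m \<psi>\<close> below.
\<close>

lemma invertible_A0_diff:
  assumes u: "u \<in> Linf_I" and H: "H \<in> Linf_I" and K: "bounded_clinear K"
    and KM: "\<And>\<phi>. K (mult_I u \<phi> - c *\<^sub>C \<phi>) = \<phi>"
    and MK: "\<And>\<phi>. mult_I u (K \<phi>) - c *\<^sub>C K \<phi> = \<phi>"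
    and s: "\<And>d. mean_I (K (mult_I H (K (const_I d)))) = s *\<^sub>C const_I d"
    and ne: "complex_of_real g * s \<noteq> 1"
  shows "invertible_operator (\<lambda>x. A0 g u H x - c *\<^sub>C x)"
proof -
  define D where "D = 1 - complex_of_real g * s"
  have D: "D \<noteq> 0"
    using ne by (simp add: D_def)
  \<comment> \<open>With \<open>m\<close> the mean of \<open>\<phi>\<^sub>1\<close>, the second row
    gives \<open>\<phi>\<^sub>2 = K (\<psi>\<^sub>2 - g m)\<close> and the first gives
    \<open>\<phi>\<^sub>1 = K (\<psi>\<^sub>1 - H \<phi>\<^sub>2)\<close>. Taking means,
    \<open>m\<close> equals the mean of \<open>K (\<psi>\<^sub>1 - H K \<psi>\<^sub>2)\<close> plus
    \<open>g s m\<close>; hence the division by \<open>D\<close>.\<close>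
  define m where "m \<psi> = (1 / D) *\<^sub>C mean_I (K (fst \<psi> - mult_I H (K (snd \<psi>))))" for \<psi>
  define S2 where "S2 \<psi> = K (snd \<psi> - complex_of_real g *\<^sub>C m \<psi>)" for \<psi>
  define S where "S \<psi> = (K (fst \<psi> - mult_I H (S2 \<psi>)), S2 \<psi>)" for \<psi>
  note [simp] = clinear_simps[OF K] clinear_simps[OF bounded_clinear_mult_I[OF H]]
    clinear_simps[OF bounded_clinear_mean_I] scaleC_add_right scaleC_scaleC scaleC_simps
  have "bounded_clinear S"
    unfolding S_def S2_def m_def
    by (intro bounded_clinear_Pair bounded_clinear_diff bounded_clinear_compose[OF K]
        bounded_clinear_compose[OF bounded_clinear_mult_I[OF H]] bounded_clinear_fst
        bounded_clinear_snd bounded_clinear_compose[OF bounded_clinear_mean_I]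
        bounded_clinear_compose[OF bounded_clinear_scaleC])
  moreover have "A0 g u H (S \<psi>) - c *\<^sub>C S \<psi> = \<psi>" for \<psi>
  proof -
    \<comment> \<open>Assumption \<open>s\<close> speaks of constant functions only, so
      \<open>m \<psi>\<close> has to be exhibited as one.\<close>
    have "m \<psi> = const_I (1 / D * integral_I (K (fst \<psi> - mult_I H (K (snd \<psi>)))))"
      by (simp only: m_def mean_I_def const_I_mult)
    then obtain d where d: "m \<psi> = const_I d"
      by blast
    have "D *\<^sub>C m \<psi> = mean_I (K (fst \<psi> - mult_I H (K (snd \<psi>))))"
      using D by (simp add: m_def)
    then have "mean_I (fst (S \<psi>)) = D *\<^sub>C m \<psi> + (complex_of_real g * s) *\<^sub>C m \<psi>"
      by (simp add: S_def S2_def s d algebra_simps)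
    also have "\<dots> = m \<psi>"
      by (simp add: D_def)
    finally have "const_I (complex_of_real g * integral_I (fst (S \<psi>))) = complex_of_real g *\<^sub>C m \<psi>"
      by (simp add: const_I_mult mean_I_def)
    moreover have "mult_I u (S2 \<psi>) - c *\<^sub>C S2 \<psi> = snd \<psi> - complex_of_real g *\<^sub>C m \<psi>"
      unfolding S2_def by (rule MK)
    moreover have "mult_I u (fst (S \<psi>)) - c *\<^sub>C fst (S \<psi>) = fst \<psi> - mult_I H (S2 \<psi>)"
      unfolding S_def fst_conv by (rule MK)
    moreover have "snd (S \<psi>) = S2 \<psi>"
      by (simp add: S_def)
    ultimately show ?thesis
      by (simp add: A0_def case_prod_beta scaleC_prod_def prod_eq_iff algebra_simps)
  qed
  moreover have "S (A0 g u H \<phi> - c *\<^sub>C \<phi>) = \<phi>" for \<phi>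
  proof -
    define \<psi> where "\<psi> = A0 g u H \<phi> - c *\<^sub>C \<phi>"
    have \<psi>: "fst \<psi> = (mult_I u (fst \<phi>) - c *\<^sub>C fst \<phi>) + mult_I H (snd \<phi>)"
      "snd \<psi> = complex_of_real g *\<^sub>C mean_I (fst \<phi>) + (mult_I u (snd \<phi>) - c *\<^sub>C snd \<phi>)"
      by (simp_all add: \<psi>_def A0_def scaleC_prod_def case_prod_beta mean_I_def const_I_mult)
    have K1: "K (fst \<psi>) = fst \<phi> + K (mult_I H (snd \<phi>))"
      unfolding \<psi> clinear_simps(1)[OF K] KM ..
    have K2: "K (snd \<psi>) = complex_of_real g *\<^sub>C K (mean_I (fst \<phi>)) + snd \<phi>"
      unfolding \<psi> clinear_simps(1,3)[OF K] KM ..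
    \<comment> \<open>By \<open>K1\<close> and \<open>K2\<close> the terms
      \<open>K H \<phi>\<^sub>2\<close> cancel, leaving \<open>\<phi>\<^sub>1 - g K H K\<close>
      applied to the mean of \<open>\<phi>\<^sub>1\<close>; taking the mean again produces the
      factor \<open>1 - g s\<close>.\<close>
    have "mean_I (K (fst \<psi> - mult_I H (K (snd \<psi>)))) = D *\<^sub>C mean_I (fst \<phi>)"
      using s[of "integral_I (fst \<phi>)"] by (simp add: K1 K2 D_def flip: mean_I_def)
    then have m: "m \<psi> = mean_I (fst \<phi>)"
      using D by (simp add: m_def)
    have "S2 \<psi> = snd \<phi>"
      by (simp add: S2_def m K2)
    then show ?thesis
      by (simp add: S_def K1 prod_eq_iff flip: \<psi>_def)
  qed
  ultimately show ?thesis
    unfolding invertible_operator_def by (intro exI[of _ S]) (auto simp: fun_eq_iff)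
qed

section \<open>Reduction to a scalar equation\<close>

text \<open>A positive distance from \<open>c\<close> to the segment makes
  \<open>1 / (u - c)\<close> essentially bounded. One coordinate of \<open>c\<close> already
  supplies it: either \<open>Im c\<close> is nonzero or \<open>Re c\<close> lies outside the
  interval.\<close>

lemma cmod_diff_lower_bound:
  assumes "\<not> (Im c = 0 \<and> m \<le> Re c \<and> Re c \<le> p)"
  obtains \<delta> where "0 < \<delta>" "\<And>t. m \<le> t \<Longrightarrow> t \<le> p \<Longrightarrow> \<delta> \<le> cmod (complex_of_real t - c)"
proof -
  have Re: "\<bar>t - Re c\<bar> \<le> cmod (complex_of_real t - c)" for t
    using abs_Re_le_cmod[of "complex_of_real t - c"] by simp
  have Im: "\<bar>Im c\<bar> \<le> cmod (complex_of_real t - c)" for t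
    using abs_Im_le_cmod[of "complex_of_real t - c"] by simp
  consider "Im c \<noteq> 0" | "Re c < m" | "p < Re c"
    using assms by force
  then show ?thesis
  proof cases
    case 1
    then show ?thesis by (intro that[of "\<bar>Im c\<bar>"] Im) auto
  next
    case 2
    show ?thesis
    proof (rule that[of "m - Re c"])
      show "m - Re c \<le> cmod (complex_of_real t - c)" if "m \<le> t" for t
        using Re[of t] that by linarith
    qed (use 2 in simp)
  next
    case 3
    show ?thesis
    proof (rule that[of "Re c - p"])
      show "Re c - p \<le> cmod (complex_of_real t - c)" if "t \<le> p" for t
        using Re[of t] that by linarith
    qed (use 3 in simp)
  qed
qed

lemma AE_ess_bounds:
  assumes "u \<in> Linf_I"
  shows "AE x in leb_I. ess_inf_I u \<le> u x \<and> u x \<le> ess_sup_I u"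
  using ess_sup_I_le_iff[OF assms, of "ess_sup_I u"] le_ess_inf_I_iff[OF assms, of "ess_inf_I u"]
  by simp

lemma integrable_Linf_I: "u \<in> Linf_I \<Longrightarrow> integrable leb_I u"
  by (auto simp: Linf_I_iff intro!: finite_measure.integrable_const_bound[OF finite_measure_leb_I])

text \<open>Used for the weight \<open>w\<close> and its first two moments in the nonreal
  case.\<close>

lemma integrable_mult_bounded:
  fixes w f :: "real \<Rightarrow> real"
  assumes w: "integrable leb_I w" and [measurable]: "f \<in> borel_measurable leb_I"
    and B: "AE x in leb_I. \<bar>f x\<bar> \<le> B"
  shows "integrable leb_I (\<lambda>x. w x * f x)"
proof (rule Bochner_Integration.integrable_bound)
  have [measurable]: "w \<in> borel_measurable leb_I"
    using w by (rule borel_measurable_integrable)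
  show "integrable leb_I (\<lambda>x. B * w x)"
    using w by simp
  show "AE x in leb_I. norm (w x * f x) \<le> norm (B * w x)"
    using B by eventually_elim (auto simp: abs_mult mult.commute intro!: mult_right_mono)
  show "(\<lambda>x. w x * f x) \<in> borel_measurable leb_I"
    by measurable
qed

section \<open>Multiplication by bounded complex functions, and the scalar equation\<close>

text \<open>Meaningful only for \<open>w\<close> in \<open>cLinf_I\<close> below.\<close>

definition cmult_I :: "(real \<Rightarrow> complex) \<Rightarrow> L2I \<Rightarrow> L2I" where
  "cmult_I w \<phi> = mult_I (\<lambda>x. Re (w x)) \<phi> + \<i> *\<^sub>C mult_I (\<lambda>x. Im (w x)) \<phi>"

text \<open>Boundedness is asked of the two real components because \<open>cmult_I\<close> is
  assembled from two real multiplications; its boundedness is then inherited from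
  \<open>mult_I\<close>.\<close>

definition cLinf_I :: "(real \<Rightarrow> complex) set" where
  "cLinf_I = {w. (\<lambda>x. Re (w x)) \<in> Linf_I \<and> (\<lambda>x. Im (w x)) \<in> Linf_I}"

lemma cLinf_I_I:
  assumes [measurable]: "w \<in> borel_measurable leb_I" and B: "AE x in leb_I. cmod (w x) \<le> B"
  shows "w \<in> cLinf_I"
proof -
  have "AE x in leb_I. \<bar>Re (w x)\<bar> \<le> \<bar>B\<bar>" "AE x in leb_I. \<bar>Im (w x)\<bar> \<le> \<bar>B\<bar>"
    using B
    by (eventually_elim, use abs_Re_le_cmod abs_Im_le_cmod in \<open>smt (verit)\<close>)+
  moreover have "(\<lambda>x. Re (w x)) \<in> borel_measurable leb_I" "(\<lambda>x. Im (w x)) \<in> borel_measurable leb_I"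
    by measurable
  ultimately show ?thesis
    unfolding cLinf_I_def Linf_I_iff by (auto intro: exI[of _ "\<bar>B\<bar>"])
qed

lemma bounded_clinear_cmult_I: "w \<in> cLinf_I \<Longrightarrow> bounded_clinear (cmult_I w)"
  unfolding cmult_I_def[abs_def]
  by (intro bounded_clinear_add bounded_clinear_compose[OF bounded_clinear_scaleC]
      bounded_clinear_mult_I) (auto simp: cLinf_I_def)

text \<open>Any square integrable representative may be used, so identities between multiplication
  operators reduce to pointwise identities almost everywhere.\<close>

lemma
  assumes w: "w \<in> cLinf_I" and f: "square_integrable_I f"
  shows square_integrable_I_cmult: "square_integrable_I (\<lambda>x. w x * f x)"
    and cmult_I_abs: "cmult_I w (abs_L2I f) = abs_L2I (\<lambda>x. w x * f x)"
proof -
  have Re: "(\<lambda>x. Re (w x)) \<in> Linf_I" and Im: "(\<lambda>x. Im (w x)) \<in> Linf_I"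
    using w by (auto simp: cLinf_I_def)
  note sq = square_integrable_I_mult[OF Re f]
    square_integrable_I_scale[OF square_integrable_I_mult[OF Im f], of \<i>]
  have eq: "(\<lambda>x. complex_of_real (Re (w x)) * f x + \<i> * (complex_of_real (Im (w x)) * f x))
      = (\<lambda>x. w x * f x)"
    by (simp add: fun_eq_iff complex_eq_iff)
  show "square_integrable_I (\<lambda>x. w x * f x)"
    using square_integrable_I_add[OF sq] by (simp only: eq)
  show "cmult_I w (abs_L2I f) = abs_L2I (\<lambda>x. w x * f x)"
    unfolding cmult_I_def mult_I_abs[OF Re f] mult_I_abs[OF Im f]
    by (simp only: plus_L2I.abs_eq scaleC_L2I.abs_eq L2_rel_refl sq
        square_integrable_I_mult[OF Im f] eq)
qed

text \<open>Contrapositive of \<open>invertible_A0_diff\<close>: multiplication by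
  \<open>k = 1 / (u - c)\<close> plays the role of \<open>K\<close>, and on constants the compressed
  operator acts as the number \<open>s\<close>, the integral of \<open>H k^2\<close>.\<close>

lemma spectrum_A0_imp:
  assumes u: "u \<in> Linf_I" and H: "H \<in> Linf_I"
    and c: "\<not> (Im c = 0 \<and> ess_inf_I u \<le> Re c \<and> Re c \<le> ess_sup_I u)"
    and spec: "c \<in> spectrum (A0 g u H)"
  shows "complex_of_real g * (\<integral>x. complex_of_real (H x) * (1 / (complex_of_real (u x) - c)\<^sup>2) \<partial>leb_I) = 1"
proof (rule ccontr)
  assume ne: "\<not> ?thesis"
  have [measurable]: "u \<in> borel_measurable leb_I"
    using u by (simp add: Linf_I_iff)
  define k where "k x = 1 / (complex_of_real (u x) - c)" for x
  obtain \<delta> where \<delta>: "0 < \<delta>"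
    "\<And>t. ess_inf_I u \<le> t \<Longrightarrow> t \<le> ess_sup_I u \<Longrightarrow> \<delta> \<le> cmod (complex_of_real t - c)"
    using cmod_diff_lower_bound[OF c] by metis
  have far: "AE x in leb_I. \<delta> \<le> cmod (complex_of_real (u x) - c)"
    using AE_ess_bounds[OF u] by eventually_elim (use \<delta> in auto)
  have k: "k \<in> cLinf_I"
  proof (rule cLinf_I_I)
    show "k \<in> borel_measurable leb_I"
      unfolding k_def[abs_def] by measurable
    show "AE x in leb_I. cmod (k x) \<le> 1 / \<delta>"
      using far by eventually_elim (use \<delta>(1) in \<open>simp add: k_def norm_divide frac_le\<close>)
  qed
  have inv: "AE x in leb_I. k x * (complex_of_real (u x) * y x - c * y x) = y x" for y
    using far
  proof eventually_elim
    case (elim x)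
    then have "complex_of_real (u x) - c \<noteq> 0"
      using \<delta>(1) by auto
    then show ?case
      by (simp add: k_def flip: left_diff_distrib)
  qed
  have M: "mult_I u (abs_L2I f) - c *\<^sub>C abs_L2I f = abs_L2I (\<lambda>x. complex_of_real (u x) * f x - c * f x)"
    and Msq: "square_integrable_I (\<lambda>x. complex_of_real (u x) * f x - c * f x)"
    if f: "square_integrable_I f" for f
  proof -
    note sq = square_integrable_I_mult[OF u f] square_integrable_I_scale[OF f, of "-c"]
    show "square_integrable_I (\<lambda>x. complex_of_real (u x) * f x - c * f x)"
      using square_integrable_I_add[OF sq] by simp
    \<comment> \<open>The instance with both scalars 0 shows \<open>0 *\<^sub>C x = 0\<close>; the
      other one then identifies \<open>(- c) *\<^sub>C x\<close> with
      \<open>- (c *\<^sub>C x)\<close>.\<close>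
    have "mult_I u (abs_L2I f) - c *\<^sub>C abs_L2I f = mult_I u (abs_L2I f) + (- c) *\<^sub>C abs_L2I f"
      using scaleC_simps(2)[of 0 c "abs_L2I f"] scaleC_simps(2)[of 0 0 "abs_L2I f"] by simp
    also have "\<dots> = abs_L2I (\<lambda>x. complex_of_real (u x) * f x - c * f x)"
      unfolding mult_I_abs[OF u f] using f sq
      by (simp add: plus_L2I.abs_eq scaleC_L2I.abs_eq L2_rel_refl)
    finally show "mult_I u (abs_L2I f) - c *\<^sub>C abs_L2I f
        = abs_L2I (\<lambda>x. complex_of_real (u x) * f x - c * f x)" .
  qed
  have "invertible_operator (\<lambda>x. A0 g u H x - c *\<^sub>C x)"
  proof (rule invertible_A0_diff[OF u H bounded_clinear_cmult_I[OF k]])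
    fix \<phi> :: L2I
    obtain f where f: "square_integrable_I f" and \<phi>: "\<phi> = abs_L2I f"
      by (rule L2I_cases)
    show "cmult_I k (mult_I u \<phi> - c *\<^sub>C \<phi>) = \<phi>"
      unfolding \<phi> M[OF f] cmult_I_abs[OF k Msq[OF f]]
      by (subst abs_L2I_eq_iff) (use f inv in \<open>auto intro!: square_integrable_I_cmult[OF k] Msq\<close>)
    show "mult_I u (cmult_I k \<phi>) - c *\<^sub>C cmult_I k \<phi> = \<phi>"
      unfolding \<phi> cmult_I_abs[OF k f] M[OF square_integrable_I_cmult[OF k f]]
    proof (subst abs_L2I_eq_iff)
      show "AE x in leb_I. complex_of_real (u x) * (k x * f x) - c * (k x * f x) = f x"
        using inv[of f] by (simp add: algebra_simps)
    qed (use f in \<open>auto intro!: Msq square_integrable_I_cmult[OF k]\<close>)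
  next
    fix d
    let ?s = "\<integral>x. complex_of_real (H x) * (1 / (complex_of_real (u x) - c)\<^sup>2) \<partial>leb_I"
    have kd: "square_integrable_I (\<lambda>x. k x * d)"
      by (rule square_integrable_I_cmult[OF k square_integrable_I_const])
    have Hkd: "square_integrable_I (\<lambda>x. complex_of_real (H x) * (k x * d))"
      by (rule square_integrable_I_mult[OF H kd])
    have "integral_I (cmult_I k (mult_I H (cmult_I k (const_I d))))
        = (\<integral>x. k x * (complex_of_real (H x) * (k x * d)) \<partial>leb_I)"
      by (simp add: const_I.abs_eq cmult_I_abs[OF k] square_integrable_I_const mult_I_abs[OF H]
          kd Hkd integral_I.abs_eq L2_rel_refl square_integrable_I_cmult[OF k])
    also have "\<dots> = (\<integral>x. complex_of_real (H x) * (1 / (complex_of_real (u x) - c)\<^sup>2) * d \<partial>leb_I)"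
      by (intro Bochner_Integration.integral_cong)
        (simp_all add: k_def power2_eq_square)
    also have "\<dots> = ?s * d"
      by (rule integral_mult_left_zero)
    finally show "mean_I (cmult_I k (mult_I H (cmult_I k (const_I d)))) = ?s *\<^sub>C const_I d"
      by (simp only: mean_I_def const_I_mult)
  qed (rule ne)
  then show False
    using spec by (simp add: spectrum_def)
qed

section \<open>Location of the roots\<close>

text \<open>A zero integral would make \<open>f\<close> vanish almost everywhere, against
  \<open>pos\<close>, since the interval has measure 1 and is not a null set.\<close>

lemma integral_pos:
  fixes f :: "real \<Rightarrow> real"
  assumes "integrable leb_I f" and pos: "AE x in leb_I. 0 < f x"
  shows "0 < (\<integral>x. f x \<partial>leb_I)"
proof -
  have nn: "AE x in leb_I. 0 \<le> f x"
    using pos by eventually_elim simp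
  have "\<not> (AE x in leb_I. f x = 0)"
  proof
    assume "AE x in leb_I. f x = 0"
    with pos have "AE x in leb_I. False"
      by eventually_elim simp
    then show False
      using measure_leb_I by (simp add: eventually_False ae_filter_eq_bot_iff measure_def)
  qed
  then show ?thesis
    using integral_nonneg_eq_0_iff_AE[OF assms(1) nn] integral_nonneg_AE[OF nn] by linarith
qed

text \<open>Absolute values in \<open>eq\<close> give \<open>1 \<le> g h / \<delta>^2\<close>, where
  \<open>h\<close> is the integral of \<open>H\<close>. All three bounds by the square root of
  \<open>g h\<close> come from here.\<close>

lemma root_distance_le:
  assumes H: "H \<in> Linf_I" and Hpos: "AE x in leb_I. 0 < H x" and g: "0 < g"
    and eq: "complex_of_real g * (\<integral>x. complex_of_real (H x) * (1 / (complex_of_real (u x) - c)\<^sup>2) \<partial>leb_I) = 1"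
    and \<delta>: "0 < \<delta>" and far: "AE x in leb_I. \<delta> \<le> cmod (complex_of_real (u x) - c)"
  shows "\<delta> \<le> sqrt (g * (\<integral>x. H x \<partial>leb_I))"
proof -
  let ?F = "\<lambda>x. complex_of_real (H x) * (1 / (complex_of_real (u x) - c)\<^sup>2)"
  \<comment> \<open>The integral of a non-integrable function is 0 by convention, which would turn
    \<open>eq\<close> into 0 = 1.\<close>
  have int: "integrable leb_I ?F"
    using eq by (metis mult_zero_right not_integrable_integral_eq zero_neq_one)
  have "1 = g * cmod (\<integral>x. ?F x \<partial>leb_I)"
    using arg_cong[OF eq, of cmod] g by (simp add: norm_mult)
  also have "\<dots> \<le> g * (\<integral>x. cmod (?F x) \<partial>leb_I)"
    using g by (intro mult_left_mono integral_norm_bound) auto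
  also have "\<dots> \<le> g * (\<integral>x. H x / \<delta>\<^sup>2 \<partial>leb_I)"
  proof (intro mult_left_mono integral_mono_AE)
    show "AE x in leb_I. cmod (?F x) \<le> H x / \<delta>\<^sup>2"
      using far Hpos
    proof eventually_elim
      case (elim x)
      then have "\<delta>\<^sup>2 \<le> (cmod (complex_of_real (u x) - c))\<^sup>2"
        using \<delta> by (intro power_mono) auto
      then show ?case
        using elim \<delta> by (simp add: norm_mult norm_divide norm_power frac_le)
    qed
  qed (use g int integrable_Linf_I[OF H] in auto)
  also have "\<dots> = g * (\<integral>x. H x \<partial>leb_I) / \<delta>\<^sup>2"
    by simp
  finally have "\<delta>\<^sup>2 \<le> g * (\<integral>x. H x \<partial>leb_I)"
    using \<delta> by (simp add: field_simps)
  then show ?thesis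
    by (rule real_le_rsqrt)
qed

text \<open>With \<open>a = Re c\<close>, the product \<open>(a - m) (a - p)\<close> equals
  \<open>(a - (m + p) / 2)^2 - ((p - m) / 2)^2\<close>, so the last claim puts \<open>c\<close>
  inside the disc with diameter from \<open>m\<close> to \<open>p\<close>. It is strict because the
  real part of \<open>eq\<close> equals 1.\<close>

lemma nonreal_root:
  assumes u: "u \<in> Linf_I" and H: "H \<in> Linf_I" and Hpos: "AE x in leb_I. 0 < H x" and g: "0 < g"
    and eq: "complex_of_real g * (\<integral>x. complex_of_real (H x) * (1 / (complex_of_real (u x) - c)\<^sup>2) \<partial>leb_I) = 1"
    and b: "Im c \<noteq> 0"
  shows "ess_inf_I u \<le> Re c" "Re c \<le> ess_sup_I u"
    "(Im c)\<^sup>2 + (Re c - ess_inf_I u) * (Re c - ess_sup_I u) < 0"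
proof -
  define m p where "m = ess_inf_I u" and "p = ess_sup_I u"
  define v where "v x = u x - Re c" for x
  \<comment> \<open>From \<open>1 / z^2 = (cnj z)^2 / |z|^4\<close> with
    \<open>z = v - \<i> Im c\<close>: this weight splits the integrand of \<open>eq\<close> into
    real polynomials in \<open>v\<close>.\<close>
  define w where "w x = H x * (1 / (cmod (complex_of_real (u x) - c)) ^ 4)" for x
  have [measurable]: "u \<in> borel_measurable leb_I"
    using u by (simp add: Linf_I_iff)
  have bnd: "AE x in leb_I. m \<le> u x \<and> u x \<le> p"
    using AE_ess_bounds[OF u] by (simp add: m_def p_def)
  have ne: "complex_of_real t \<noteq> c" for t
    using b by auto
  have wpos: "AE x in leb_I. 0 < w x"
    using Hpos by eventually_elim (simp add: w_def ne)
  have intw: "integrable leb_I w"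
    unfolding w_def[abs_def]
  proof (rule integrable_mult_bounded[OF integrable_Linf_I[OF H], where B = "1 / \<bar>Im c\<bar> ^ 4"])
    have "\<bar>Im c\<bar> ^ 4 \<le> cmod (complex_of_real t - c) ^ 4" for t
      using abs_Im_le_cmod[of "complex_of_real t - c"] by (intro power_mono) auto
    then show "AE x in leb_I. \<bar>1 / (cmod (complex_of_real (u x) - c)) ^ 4\<bar> \<le> 1 / \<bar>Im c\<bar> ^ 4"
      using b ne by (auto intro!: divide_left_mono)
  qed measurable
  obtain L where L: "AE x in leb_I. \<bar>u x\<bar> \<le> L"
    using u by (auto simp: Linf_I_iff)
  have vB: "AE x in leb_I. \<bar>v x\<bar> \<le> L + \<bar>Re c\<bar>"
    using L by eventually_elim (auto simp: v_def)
  have vm [measurable]: "v \<in> borel_measurable leb_I"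
    unfolding v_def[abs_def] by measurable
  have intv: "integrable leb_I (\<lambda>x. w x * v x)"
    by (rule integrable_mult_bounded[OF intw vm vB])
  have intv2: "integrable leb_I (\<lambda>x. w x * (v x)\<^sup>2)"
  proof (rule integrable_mult_bounded[OF intw])
    show "AE x in leb_I. \<bar>(v x)\<^sup>2\<bar> \<le> (L + \<bar>Re c\<bar>)\<^sup>2"
      using vB by eventually_elim (simp add: abs_le_square_iff power2_le_iff_abs_le)
  qed measurable
  have expand: "complex_of_real (H x) * (1 / (complex_of_real (u x) - c)\<^sup>2)
      = Complex (w x * (v x)\<^sup>2 - (Im c)\<^sup>2 * w x) (2 * Im c * (w x * v x))" for x
  proof -
    let ?z = "complex_of_real (u x) - c"
    have "1 / z\<^sup>2 = (cnj z)\<^sup>2 / (z * cnj z)\<^sup>2" if "z \<noteq> 0" for z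
      using that by (simp add: power_mult_distrib)
    from this[of ?z] have "1 / ?z\<^sup>2 = (cnj ?z)\<^sup>2 / (?z * cnj ?z)\<^sup>2"
      using ne[of "u x"] by simp
    also have "?z * cnj ?z = complex_of_real ((cmod ?z)\<^sup>2)"
      by (rule complex_norm_square[symmetric])
    finally have "1 / ?z\<^sup>2 = (cnj ?z)\<^sup>2 / complex_of_real ((cmod ?z) ^ 4)"
      by (simp flip: of_real_power)
    moreover have "(cnj ?z)\<^sup>2 = Complex ((v x)\<^sup>2 - (Im c)\<^sup>2) (2 * Im c * v x)"
      by (simp add: complex_eq_iff power2_eq_square v_def)
    ultimately have "1 / ?z\<^sup>2
        = Complex ((v x)\<^sup>2 - (Im c)\<^sup>2) (2 * Im c * v x) / complex_of_real ((cmod ?z) ^ 4)"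
      by simp
    then show ?thesis
      by (simp only:)
        (simp add: complex_eq_iff w_def Re_divide_of_real Im_divide_of_real diff_divide_distrib
          algebra_simps del: of_real_power)
  qed
  define F where "F x = complex_of_real (H x) * (1 / (complex_of_real (u x) - c)\<^sup>2)" for x
  have F: "Re (F x) = w x * (v x)\<^sup>2 - (Im c)\<^sup>2 * w x" "Im (F x) = 2 * Im c * (w x * v x)" for x
    unfolding F_def expand by simp_all
  have intF: "integrable leb_I F"
    using eq unfolding F_def[symmetric]
    by (metis mult_zero_right not_integrable_integral_eq zero_neq_one)
  have eqF: "complex_of_real g * (\<integral>x. F x \<partial>leb_I) = 1"
    using eq by (simp add: F_def)
  have "g * (\<integral>x. Re (F x) \<partial>leb_I) = 1" "g * (\<integral>x. Im (F x) \<partial>leb_I) = 0"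
    using arg_cong[OF eqF, of Re] arg_cong[OF eqF, of Im] intF by simp_all
  \<comment> \<open>The imaginary part carries the nonzero factor \<open>2 g Im c\<close>;
    cancelling it leaves the first moment of \<open>v\<close>.\<close>
  then have re: "g * ((\<integral>x. w x * (v x)\<^sup>2 \<partial>leb_I) - (Im c)\<^sup>2 * (\<integral>x. w x \<partial>leb_I)) = 1"
    and im: "(\<integral>x. w x * v x \<partial>leb_I) = 0"
    using g b intw intv2 by (simp_all add: F)
  show "m \<le> Re c"
  proof (rule ccontr)
    assume "\<not> m \<le> Re c"
    then have "AE x in leb_I. 0 < w x * v x"
      using bnd wpos by (auto simp: v_def elim: eventually_elim2)
    from integral_pos[OF intv this] im show False by simp
  qed
  show "Re c \<le> p"
  proof (rule ccontr)
    assume "\<not> Re c \<le> p"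
    then have "AE x in leb_I. 0 < - (w x * v x)"
      using bnd wpos by (auto simp: v_def mult_pos_neg elim: eventually_elim2)
    from integral_pos[OF integrable_minus[OF intv] this] im show False by simp
  qed
  have wint: "0 < (\<integral>x. w x \<partial>leb_I)"
    by (rule integral_pos[OF intw wpos])
  let ?q = "(Re c - m) * (Re c - p)"
  \<comment> \<open>The integrand is \<open>w (u - m) (u - p)\<close> expanded in powers of
    \<open>v\<close>; the linear term integrates to 0 by \<open>im\<close>.\<close>
  have "(\<integral>x. w x * (v x)\<^sup>2 + (2 * Re c - m - p) * (w x * v x) + ?q * w x \<partial>leb_I)
      \<le> (\<integral>x. 0 \<partial>leb_I)"
  proof (rule integral_mono_AE)
    show "AE x in leb_I. w x * (v x)\<^sup>2 + (2 * Re c - m - p) * (w x * v x) + ?q * w x \<le> 0"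
      using bnd wpos
    proof eventually_elim
      case (elim x)
      have "w x * (v x)\<^sup>2 + (2 * Re c - m - p) * (w x * v x) + ?q * w x
          = w x * ((u x - m) * (u x - p))"
        by (simp add: v_def power2_eq_square algebra_simps)
      also have "\<dots> \<le> 0"
        using elim by (intro mult_nonneg_nonpos) auto
      finally show ?case .
    qed
  qed (use intw intv intv2 in auto)
  then have "(\<integral>x. w x * (v x)\<^sup>2 \<partial>leb_I) + ?q * (\<integral>x. w x \<partial>leb_I) \<le> 0"
    using intw intv intv2 im by simp
  \<comment> \<open>By \<open>re\<close> this quantity times \<open>g\<close> is 1, so the second
    moment of \<open>v\<close> exceeds \<open>(Im c)^2\<close> times the mass of
    \<open>w\<close>.\<close>
  moreover have "0 < (\<integral>x. w x * (v x)\<^sup>2 \<partial>leb_I) - (Im c)\<^sup>2 * (\<integral>x. w x \<partial>leb_I)"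
    using re g by (metis zero_less_mult_pos zero_less_one)
  ultimately have "((Im c)\<^sup>2 + ?q) * (\<integral>x. w x \<partial>leb_I) < 0"
    by (simp add: algebra_simps)
  then show "(Im c)\<^sup>2 + ?q < 0"
    using wint by (simp add: mult_less_0_iff)
qed

section \<open>Assembling the three regions\<close>

theorem proposition4p6:
  fixes g :: real and u H :: "real \<Rightarrow> real"
  assumes "0 < g"
    and "u \<in> Linf_I" and "H \<in> Linf_I"
    and "0 < ess_inf_I H"
  shows "let u\<^sub>m = ess_inf_I u; u\<^sub>p = ess_sup_I u; h = (\<integral>x. H x \<partial>leb_I);
             J\<^sub>m = complex_of_real ` {u\<^sub>m - sqrt (g * h) ..< u\<^sub>m};
             J\<^sub>p = complex_of_real ` {u\<^sub>p <.. u\<^sub>p + sqrt (g * h)};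
             R = {z. u\<^sub>m \<le> Re z \<and> Re z \<le> u\<^sub>p \<and> \<bar>Im z\<bar> \<le> sqrt (g * h) \<and>
                     cmod (z - complex_of_real ((u\<^sub>m + u\<^sub>p) / 2)) \<le> (u\<^sub>p - u\<^sub>m) / 2}
         in spectrum (A0 g u H) \<subseteq> J\<^sub>m \<union> J\<^sub>p \<union> R"
proof -
  define m p s where "m = ess_inf_I u" and "p = ess_sup_I u"
    and "s = sqrt (g * (\<integral>x. H x \<partial>leb_I))"
  have Hpos: "AE x in leb_I. 0 < H x"
    using AE_ess_bounds[OF assms(3)] by eventually_elim (use assms(4) in linarith)
  have bnd: "AE x in leb_I. m \<le> u x \<and> u x \<le> p"
    using AE_ess_bounds[OF assms(2)] by (simp add: m_def p_def)
  have s0: "0 \<le> s"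
    using integral_pos[OF integrable_Linf_I[OF assms(3)] Hpos] assms(1) by (simp add: s_def)
  \<comment> \<open>Completing the square in \<open>Re z\<close>. The weak inequality lets this
    serve real points of the segment as well as nonreal roots.\<close>
  have disk: "cmod (z - complex_of_real ((m + p) / 2)) \<le> (p - m) / 2"
    if "m \<le> Re z" "Re z \<le> p" "(Im z)\<^sup>2 + (Re z - m) * (Re z - p) \<le> 0" for z
  proof (rule power2_le_imp_le)
    have "(cmod (z - complex_of_real ((m + p) / 2)))\<^sup>2 = (Re z - (m + p) / 2)\<^sup>2 + (Im z)\<^sup>2"
      by (simp only: cmod_power2 minus_complex.sel Re_complex_of_real Im_complex_of_real diff_zero)
    also have "\<dots> = (Im z)\<^sup>2 + (Re z - m) * (Re z - p) + ((p - m) / 2)\<^sup>2"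
      by (simp add: power2_eq_square field_simps)
    finally show "(cmod (z - complex_of_real ((m + p) / 2)))\<^sup>2 \<le> ((p - m) / 2)\<^sup>2"
      using that(3) by simp
  qed (use that in simp)
  have "c \<in> complex_of_real ` {m - s ..< m} \<union> complex_of_real ` {p <.. p + s} \<union>
      {z. m \<le> Re z \<and> Re z \<le> p \<and> \<bar>Im z\<bar> \<le> s \<and> cmod (z - complex_of_real ((m + p) / 2)) \<le> (p - m) / 2}"
    if spec: "c \<in> spectrum (A0 g u H)" for c
  proof (cases "Im c = 0 \<and> m \<le> Re c \<and> Re c \<le> p")
    case True
    \<comment> \<open>Points of the real segment from \<open>m\<close> to \<open>p\<close> lie in
      \<open>R\<close> whether spectral or not: \<open>Im c\<close> is 0 and
      \<open>(Re c - m) (Re c - p) \<le> 0\<close>.\<close>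
    then show ?thesis
      using disk[of c] s0 by (simp add: mult_nonneg_nonpos)
  next
    case False
    then have eq: "complex_of_real g *
        (\<integral>x. complex_of_real (H x) * (1 / (complex_of_real (u x) - c)\<^sup>2) \<partial>leb_I) = 1"
      by (intro spectrum_A0_imp[OF assms(2,3) _ spec]) (simp add: m_def p_def)
    \<comment> \<open>Applied below with \<open>\<delta>\<close> equal to \<open>m - Re c\<close>,
      \<open>Re c - p\<close> and \<open>\<bar>Im c\<bar>\<close> in turn.\<close>
    note dist = root_distance_le[OF assms(3) Hpos assms(1) eq, folded s_def]
    have Re: "\<bar>t - Re c\<bar> \<le> cmod (complex_of_real t - c)" for t
      using abs_Re_le_cmod[of "complex_of_real t - c"] by simp
    consider "Im c = 0" "Re c < m" | "Im c = 0" "p < Re c" | "Im c \<noteq> 0"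
      using False by force
    then show ?thesis
    proof cases
      case 1
      have "AE x in leb_I. m - Re c \<le> cmod (complex_of_real (u x) - c)"
        using bnd by eventually_elim (use Re in \<open>smt (verit)\<close>)
      with dist[of "m - Re c"] 1 have "Re c \<in> {m - s ..< m}"
        by simp
      moreover have "c = complex_of_real (Re c)"
        using 1 by (simp add: complex_eq_iff)
      ultimately show ?thesis
        by blast
    next
      case 2
      have "AE x in leb_I. Re c - p \<le> cmod (complex_of_real (u x) - c)"
        using bnd by eventually_elim (use Re in \<open>smt (verit)\<close>)
      with dist[of "Re c - p"] 2 have "Re c \<in> {p <.. p + s}"
        by simp
      moreover have "c = complex_of_real (Re c)"
        using 2 by (simp add: complex_eq_iff)
      ultimately show ?thesis
        by blast
    next
      case 3
      have "\<bar>Im c\<bar> \<le> cmod (complex_of_real t - c)" for t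
        using abs_Im_le_cmod[of "complex_of_real t - c"] by simp
      then have "\<bar>Im c\<bar> \<le> s"
        using dist[of "\<bar>Im c\<bar>"] 3 by simp
      then show ?thesis
        using nonreal_root[OF assms(2,3) Hpos assms(1) eq 3] disk[of c] by (simp add: m_def p_def)
    qed
  qed
  then show ?thesis
    unfolding Let_def m_def p_def s_def by blast
qed

end
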